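(* Let $r_j$, $b_j$, $\alpha_{\nu,j}$ be given according to one of the following two cases: (PG) $r_j>1/2$ for $j\in\mathbb{N}$ with $\sum_{j\in\mathbb{N}}2^{-r_j}<\infty$, and $\alpha_{\nu,j}:=(\nu+1)^{r_j}$ for $\nu,j\in\mathbb{N}$; (EG with sub-exponential growth) $r_j>0$ for $j\in\mathbb{N}$ with $\sum_{j\in\mathbb{N}}2^{-r_j}<\infty$, $b_j>0$ for $j\in\mathbb{N}$ with $\inf_{j\in\mathbb{N}}b_j>0$ and $\limsup_{j\to\infty}b_j<1$, and $\alpha_{\nu,j}:=2^{r_j\cdot\nu^{b_j}}$ for $\nu,j\in\mathbb{N}$. Let $\hat r:=\liminf_{j\to\infty}\frac{r_j}{\ln(j)}$. If $\hat r>1/\ln(2)$, then $$\bigcap_{\nu\in\mathbb{N}}\ell^{2\nu}(\boldsymbol{\alpha}_\nu^{-1})\subsetneq\bigcap_{\nu=1}^{\nu_0}\ell^{2\nu}(\boldsymbol{\alpha}_\nu^{-1})$$ for every $\nu_0\in\mathbb{N}$.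
   Context: $\mathbb{N}=\{1,2,\dots\}$. For $\nu\in\mathbb{N}$, $\boldsymbol{\alpha}_\nu^{-1}:=(\alpha_{\nu,j}^{-1})_{j\in\mathbb{N}}$ and $\ell^{2\nu}(\boldsymbol{\alpha}_\nu^{-1})$ is the set of all $\boldsymbol{x}\in\mathbb{R}^{\mathbb{N}}$ with $\sum_{j\in\mathbb{N}}\alpha_{\nu,j}^{-1}x_j^{2\nu}<\infty$. (In both cases the paper also fixes weights $\alpha_{0,j}>0$ with $\sum_{j\in\mathbb{N}}|\alpha_{0,j}-1|<\infty$, which do not enter the statement.) *)

theory Defs
  imports "HOL-Analysis.Analysis"
begin

text \<open>
  Here the natural numbers start at 1, so all index sets are \<open>{1..}\<close>; the values of
  \<open>r\<close>, \<open>b\<close>, \<open>\<alpha>\<close> at index 0 are irrelevant. Sequences indexed by \<open>{1..}\<close> are functions that are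
  extensional outside that set.
\<close>

definition ell :: "nat \<Rightarrow> (nat \<Rightarrow> real) \<Rightarrow> (nat \<Rightarrow> real) set" where
  "ell p w = {x \<in> {1..} \<rightarrow>\<^sub>E UNIV. (\<lambda>j. w j * x j ^ p) summable_on {1..}}"
  \<comment> \<open>used with even \<open>p\<close> and positive \<open>w\<close>, where summability means that the sum is finite\<close>

definition PG :: "(nat \<Rightarrow> real) \<Rightarrow> (nat \<Rightarrow> nat \<Rightarrow> real) \<Rightarrow> bool" where
  "PG r \<alpha> \<longleftrightarrow>
     (\<forall>j\<ge>1. r j > 1 / 2) \<and>
     (\<lambda>j. 2 powr (- r j)) summable_on {1..} \<and>
     (\<forall>\<nu>\<ge>1. \<forall>j\<ge>1. \<alpha> \<nu> j = (real \<nu> + 1) powr r j)"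

definition EG_sub :: "(nat \<Rightarrow> real) \<Rightarrow> (nat \<Rightarrow> real) \<Rightarrow> (nat \<Rightarrow> nat \<Rightarrow> real) \<Rightarrow> bool" where
  "EG_sub r b \<alpha> \<longleftrightarrow>
     (\<forall>j\<ge>1. r j > 0) \<and>
     (\<lambda>j. 2 powr (- r j)) summable_on {1..} \<and>
     (\<forall>j\<ge>1. b j > 0) \<and>
     (INF j\<in>{1..}. b j) > 0 \<and>
     limsup (\<lambda>j. ereal (b j)) < 1 \<and>
     (\<forall>\<nu>\<ge>1. \<forall>j\<ge>1. \<alpha> \<nu> j = 2 powr (r j * real \<nu> powr b j))"

end

theory Submission
  imports Defs "HOL-Real_Asymp.Real_Asymp"
begin

text \<open>
  In both cases the weights have the form \<open>\<alpha> \<nu> j = 2 powr (r j * c \<nu> j)\<close> with an exponent that is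
  at least \<open>1\<close> and grows sublinearly in \<open>\<nu>\<close>: \<open>c \<mu> j / \<mu>\<close> becomes arbitrarily small for large \<open>\<mu>\<close>,
  uniformly in all large \<open>j\<close> (\<open>PG_sublinear_exponent\<close>, \<open>EG_sub_sublinear_exponent\<close>).

  For a suitable \<open>\<mu> > \<nu>\<^sub>0\<close> the separating sequence is \<open>x j = \<alpha> \<mu> j powr (1 / (2 * \<mu>))\<close>. All terms of
  its \<open>\<mu>\<close>-th series are \<open>1\<close>, so that series diverges. For \<open>\<nu> \<le> \<nu>\<^sub>0\<close>, the \<open>j\<close>-th term of its \<open>\<nu>\<close>-th
  series is \<open>2 powr (- r j * (c \<nu> j - \<nu> * c \<mu> j / \<mu>))\<close>. By sublinearity, the factor in parentheses
  is eventually at least any prescribed \<open>\<delta> < 1\<close>, once \<open>\<mu>\<close> is large enough. The assumption on \<open>r\<close> says that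
  \<open>2 powr (- r j) \<le> j powr (- s)\<close> eventually, for some \<open>s > 1\<close>. So there is room to choose \<open>\<delta> < 1\<close>
  with \<open>s * \<delta> > 1\<close>, and the terms are eventually dominated by the convergent series of
  \<open>j powr (- (s * \<delta>))\<close>.
\<close>

lemma PG_sublinear_exponent:
  assumes "PG r \<alpha>" and "\<epsilon> > 0"
  shows "\<exists>c. (\<forall>\<nu>\<ge>1. \<forall>j\<ge>1. \<alpha> \<nu> j = 2 powr (r j * c \<nu> j) \<and> c \<nu> j \<ge> 1) \<and>
             (\<exists>\<mu>>\<nu>\<^sub>0. \<forall>\<^sub>F j in sequentially. c \<mu> j / real \<mu> \<le> \<epsilon>)"
proof (rule exI[of _ "\<lambda>(\<nu>::nat) (j::nat). log 2 (real \<nu> + 1)"], rule conjI)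
  let ?c = "\<lambda>(\<nu>::nat) (j::nat). log 2 (real \<nu> + 1)"
  show "\<forall>\<nu>\<ge>1. \<forall>j\<ge>1. \<alpha> \<nu> j = 2 powr (r j * ?c \<nu> j) \<and> ?c \<nu> j \<ge> 1"
  proof (intro allI impI conjI)
    fix \<nu> j :: nat assume "\<nu> \<ge> 1" "j \<ge> 1"
    then have "\<alpha> \<nu> j = (2 powr log 2 (real \<nu> + 1)) powr r j"
      using assms(1) by (simp add: PG_def)
    then show "\<alpha> \<nu> j = 2 powr (r j * log 2 (real \<nu> + 1))"
      by (simp only: powr_powr mult.commute)
    show "log 2 (real \<nu> + 1) \<ge> 1"
      using \<open>\<nu> \<ge> 1\<close> by simp
  qed
  have "(\<lambda>\<mu>. log 2 (real \<mu> + 1) / real \<mu>) \<longlonglongrightarrow> 0"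
    by real_asymp
  then have "\<forall>\<^sub>F \<mu> in sequentially. log 2 (real \<mu> + 1) / real \<mu> < \<epsilon>"
    using assms(2) by (rule order_tendstoD(2))
  then have "\<forall>\<^sub>F \<mu> in sequentially. \<nu>\<^sub>0 < \<mu> \<and> log 2 (real \<mu> + 1) / real \<mu> < \<epsilon>"
    by (rule eventually_conj[OF eventually_gt_at_top])
  then obtain \<mu> where "\<nu>\<^sub>0 < \<mu>" "log 2 (real \<mu> + 1) / real \<mu> < \<epsilon>"
    by (auto simp: eventually_sequentially)
  then show "\<exists>\<mu>>\<nu>\<^sub>0. \<forall>\<^sub>F j in sequentially. ?c \<mu> j / real \<mu> \<le> \<epsilon>"
    by (intro exI[of _ \<mu>]) simp
qed

text \<open>
  The bound on \<open>c \<mu> j / \<mu>\<close> is uniform in \<open>j\<close> because the exponents \<open>b j\<close> eventually stay below a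
  fixed \<open>\<beta> < 1\<close>, so that \<open>c \<mu> j / \<mu> \<le> \<mu> powr (\<beta> - 1)\<close>.
\<close>
lemma EG_sub_sublinear_exponent:
  assumes "EG_sub r b \<alpha>" and "\<epsilon> > 0"
  shows "\<exists>c. (\<forall>\<nu>\<ge>1. \<forall>j\<ge>1. \<alpha> \<nu> j = 2 powr (r j * c \<nu> j) \<and> c \<nu> j \<ge> 1) \<and>
             (\<exists>\<mu>>\<nu>\<^sub>0. \<forall>\<^sub>F j in sequentially. c \<mu> j / real \<mu> \<le> \<epsilon>)"
proof (rule exI[of _ "\<lambda>(\<nu>::nat) (j::nat). real \<nu> powr b j"], rule conjI)
  let ?c = "\<lambda>(\<nu>::nat) (j::nat). real \<nu> powr b j"
  show "\<forall>\<nu>\<ge>1. \<forall>j\<ge>1. \<alpha> \<nu> j = 2 powr (r j * ?c \<nu> j) \<and> ?c \<nu> j \<ge> 1"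
    using assms(1) by (auto simp: EG_sub_def less_imp_le intro: ge_one_powr_ge_zero)
  have "limsup (\<lambda>j. ereal (b j)) < ereal 1"
    using assms(1) by (simp add: EG_sub_def one_ereal_def)
  then obtain \<beta> where \<beta>: "limsup (\<lambda>j. ereal (b j)) < ereal \<beta>" "\<beta> < 1"
    using ereal_dense2 by force
  have b_le: "\<forall>\<^sub>F j in sequentially. b j < \<beta>"
    using Limsup_lessD[OF \<beta>(1)] by simp
  have "(\<lambda>\<mu>. real \<mu> powr (\<beta> - 1)) \<longlonglongrightarrow> 0"
    using \<beta>(2) by real_asymp
  then have "\<forall>\<^sub>F \<mu> in sequentially. real \<mu> powr (\<beta> - 1) < \<epsilon>"
    using assms(2) by (rule order_tendstoD(2))
  then have "\<forall>\<^sub>F \<mu> in sequentially. \<nu>\<^sub>0 < \<mu> \<and> real \<mu> powr (\<beta> - 1) < \<epsilon>"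
    by (rule eventually_conj[OF eventually_gt_at_top])
  then obtain \<mu> where \<mu>: "\<nu>\<^sub>0 < \<mu>" "real \<mu> powr (\<beta> - 1) < \<epsilon>"
    by (auto simp: eventually_sequentially)
  have "\<forall>\<^sub>F j in sequentially. ?c \<mu> j / real \<mu> \<le> \<epsilon>"
    using b_le
  proof eventually_elim
    case (elim j)
    have "real \<mu> powr b j / real \<mu> = real \<mu> powr (b j - 1)"
      using \<mu>(1) by (simp add: powr_diff)
    also have "\<dots> \<le> real \<mu> powr (\<beta> - 1)"
      using elim \<mu>(1) by (intro powr_mono) auto
    finally show ?case
      using \<mu>(2) by simp
  qed
  then show "\<exists>\<mu>>\<nu>\<^sub>0. \<forall>\<^sub>F j in sequentially. ?c \<mu> j / real \<mu> \<le> \<epsilon>"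
    using \<mu>(1) by blast
qed

lemma summable_on_eventually_le_powr:
  fixes f :: "nat \<Rightarrow> real"
  assumes "\<And>j. f j \<ge> 0" and "\<forall>\<^sub>F j in sequentially. f j \<le> real j powr (- p)" and "p > 1"
  shows "f summable_on A"
proof -
  have "summable (\<lambda>j. real j powr (- p))"
    using assms(3) by (simp add: summable_real_powr_iff)
  moreover have "\<forall>\<^sub>F j in sequentially. norm (norm (f j)) \<le> real j powr (- p)"
    using assms(1,2) by simp
  ultimately have "summable (\<lambda>j. norm (f j))"
    by (rule summable_comparison_test_ev[rotated])
  then have "f summable_on UNIV"
    by (rule norm_summable_imp_summable_on)
  then show ?thesis
    by (rule summable_on_subset_banach) simp
qed

lemma eventually_two_powr_le_powr:
  fixes r :: "nat \<Rightarrow> real"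
  assumes "liminf (\<lambda>j. ereal (r j / ln (real j))) > ereal (1 / ln 2)"
  obtains s where "s > 1"
    and "\<forall>\<^sub>F j in sequentially. r j > 0 \<and> 2 powr (- r j) \<le> real j powr (- s)"
proof -
  obtain t where t: "1 / ln 2 < t" "ereal t < liminf (\<lambda>j. ereal (r j / ln (real j)))"
    using ereal_dense2[OF assms] by auto
  have "t > 0"
    using t(1) by (rule less_trans[rotated]) simp
  have "\<forall>\<^sub>F j in sequentially. t < r j / ln (real j)"
    using less_LiminfD[OF t(2)] by simp
  then have "\<forall>\<^sub>F j in sequentially. r j > 0 \<and> 2 powr (- r j) \<le> real j powr (- (t * ln 2))"
    using eventually_gt_at_top[of 1]
  proof eventually_elim
    case (elim j)
    then have "ln (real j) > 0"
      by simp
    then have r: "t * ln (real j) < r j"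
      using elim(1) by (simp add: field_simps)
    then have "0 < r j"
      using \<open>t > 0\<close> \<open>ln (real j) > 0\<close> by (meson less_trans mult_pos_pos)
    moreover have "2 powr (- r j) \<le> 2 powr (- (t * ln (real j)))"
      using r by simp
    moreover have "2 powr (- (t * ln (real j))) = real j powr (- (t * ln 2))"
      using elim(2) by (simp add: powr_def)
    ultimately show ?case
      by simp
  qed
  moreover have "t * ln 2 > 1"
    using t(1) by (simp add: field_simps)
  ultimately show ?thesis
    using that by blast
qed

theorem proposition3p19:
  fixes r b :: "nat \<Rightarrow> real" and \<alpha> :: "nat \<Rightarrow> nat \<Rightarrow> real" and \<nu>\<^sub>0 :: nat
  assumes "PG r \<alpha> \<or> EG_sub r b \<alpha>"
    and "liminf (\<lambda>j. ereal (r j / ln (real j))) > ereal (1 / ln 2)"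
    and "\<nu>\<^sub>0 \<ge> 1"
  shows "(\<Inter>\<nu>\<in>{1..}. ell (2 * \<nu>) (\<lambda>j. inverse (\<alpha> \<nu> j)))
           \<subset> (\<Inter>\<nu>\<in>{1..\<nu>\<^sub>0}. ell (2 * \<nu>) (\<lambda>j. inverse (\<alpha> \<nu> j)))"
proof -
  obtain s where s: "s > 1"
    and r: "\<forall>\<^sub>F j in sequentially. r j > 0 \<and> 2 powr (- r j) \<le> real j powr (- s)"
    using eventually_two_powr_le_powr[OF assms(2)] .
  \<comment> \<open>any number strictly between \<open>1 / s\<close> and \<open>1\<close>\<close>
  define \<delta> where "\<delta> = (1 + 1 / s) / 2"
  have \<delta>: "0 < \<delta>" "\<delta> < 1" "s * \<delta> > 1"
    using s by (auto simp: \<delta>_def field_simps)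
  \<comment> \<open>small enough that \<open>c \<nu> j - \<nu> * c \<mu> j / \<mu> \<ge> 1 - \<nu>\<^sub>0 * \<epsilon> = \<delta>\<close> for all \<open>\<nu> \<le> \<nu>\<^sub>0\<close> and
    large \<open>j\<close>\<close>
  define \<epsilon> where "\<epsilon> = (1 - \<delta>) / real \<nu>\<^sub>0"
  have \<epsilon>: "\<epsilon> > 0" "real \<nu>\<^sub>0 * \<epsilon> = 1 - \<delta>"
    using \<delta>(2) assms(3) by (auto simp: \<epsilon>_def)
  have "\<exists>c. (\<forall>\<nu>\<ge>1. \<forall>j\<ge>1. \<alpha> \<nu> j = 2 powr (r j * c \<nu> j) \<and> c \<nu> j \<ge> 1) \<and>
          (\<exists>\<mu>>\<nu>\<^sub>0. \<forall>\<^sub>F j in sequentially. c \<mu> j / real \<mu> \<le> \<epsilon>)"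
    using assms(1) PG_sublinear_exponent[OF _ \<epsilon>(1)] EG_sub_sublinear_exponent[OF _ \<epsilon>(1)]
    by blast
  then obtain c \<mu> where \<alpha>: "\<And>\<nu> j. \<nu> \<ge> 1 \<Longrightarrow> j \<ge> 1 \<Longrightarrow> \<alpha> \<nu> j = 2 powr (r j * c \<nu> j)"
    and c_ge: "\<And>\<nu> j. \<nu> \<ge> 1 \<Longrightarrow> j \<ge> 1 \<Longrightarrow> c \<nu> j \<ge> 1"
    and \<mu>: "\<mu> > \<nu>\<^sub>0" and c_le: "\<forall>\<^sub>F j in sequentially. c \<mu> j / real \<mu> \<le> \<epsilon>"
    by blast
  define x where "x = (\<lambda>j\<in>{1..}. 2 powr (r j * c \<mu> j / (2 * real \<mu>)))"
  have term_eq: "inverse (\<alpha> \<nu> j) * x j ^ (2 * \<nu>) =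
      2 powr (- r j * (c \<nu> j - real \<nu> * (c \<mu> j / real \<mu>)))" if "\<nu> \<ge> 1" "j \<ge> 1" for \<nu> j
  proof -
    have "x j ^ (2 * \<nu>) = 2 powr (r j * c \<mu> j / (2 * real \<mu>) * real (2 * \<nu>))"
      using that(2) by (simp add: x_def powr_power mult.commute)
    also have "r j * c \<mu> j / (2 * real \<mu>) * real (2 * \<nu>) = r j * (real \<nu> * (c \<mu> j / real \<mu>))"
      by simp
    finally have "inverse (\<alpha> \<nu> j) * x j ^ (2 * \<nu>) =
        2 powr (- (r j * c \<nu> j)) * 2 powr (r j * (real \<nu> * (c \<mu> j / real \<mu>)))"
      using \<alpha>[OF that] by (simp only: powr_minus)
    then show ?thesis
      by (simp only: powr_add[symmetric]) (simp add: algebra_simps)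
  qed
  have "x \<in> ell (2 * \<nu>) (\<lambda>j. inverse (\<alpha> \<nu> j))" if \<nu>: "1 \<le> \<nu>" "\<nu> \<le> \<nu>\<^sub>0" for \<nu>
  proof -
    let ?f = "\<lambda>j. 2 powr (- r j * (c \<nu> j - real \<nu> * (c \<mu> j / real \<mu>)))"
    have "\<forall>\<^sub>F j in sequentially. ?f j \<le> real j powr (- (s * \<delta>))"
      using r c_le eventually_ge_at_top[of 1]
    proof eventually_elim
      case (elim j)
      have "real \<nu> * (c \<mu> j / real \<mu>) \<le> real \<nu> * \<epsilon>"
        using elim(2) by (intro mult_left_mono) auto
      also have "\<dots> \<le> real \<nu>\<^sub>0 * \<epsilon>"
        using \<nu>(2) \<epsilon>(1) by (intro mult_right_mono) auto
      finally have "\<delta> \<le> c \<nu> j - real \<nu> * (c \<mu> j / real \<mu>)"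
        using c_ge[OF \<nu>(1) elim(3)] \<epsilon>(2) by linarith
      then have "- r j * (c \<nu> j - real \<nu> * (c \<mu> j / real \<mu>)) \<le> - r j * \<delta>"
        using elim(1) by (intro mult_left_mono_neg) auto
      then have "?f j \<le> 2 powr (- r j * \<delta>)"
        by (intro powr_mono) auto
      also have "\<dots> = (2 powr (- r j)) powr \<delta>"
        by (simp only: powr_powr)
      also have "\<dots> \<le> (real j powr (- s)) powr \<delta>"
        using elim(1) \<delta>(1) by (intro powr_mono2) auto
      also have "\<dots> = real j powr (- (s * \<delta>))"
        by (simp add: powr_powr)
      finally show ?case .
    qed
    then have "?f summable_on {1..}"
      using \<delta>(3) by (intro summable_on_eventually_le_powr[of _ "s * \<delta>"]) simp_all
    also have "?f summable_on {1..} \<longleftrightarrow>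
        (\<lambda>j. inverse (\<alpha> \<nu> j) * x j ^ (2 * \<nu>)) summable_on {1..}"
      using term_eq[OF \<nu>(1)] by (intro summable_on_cong) simp
    finally show ?thesis
      by (simp add: ell_def x_def)
  qed
  then have in_finite: "x \<in> (\<Inter>\<nu>\<in>{1..\<nu>\<^sub>0}. ell (2 * \<nu>) (\<lambda>j. inverse (\<alpha> \<nu> j)))"
    by simp
  have not_\<mu>: "x \<notin> ell (2 * \<mu>) (\<lambda>j. inverse (\<alpha> \<mu> j))"
  proof
    assume "x \<in> ell (2 * \<mu>) (\<lambda>j. inverse (\<alpha> \<mu> j))"
    then have "(\<lambda>j. inverse (\<alpha> \<mu> j) * x j ^ (2 * \<mu>)) summable_on {1..}"
      by (simp add: ell_def)
    also have "?this \<longleftrightarrow> (\<lambda>j::nat. 1 :: real) summable_on {1..}"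
      using term_eq[of \<mu>] \<mu> by (intro summable_on_cong) simp
    finally show False
      using infsum_diverge_constant[of "{1::nat..}" "1 :: real"] by (simp add: infinite_Ici)
  qed
  have not_in_all: "x \<notin> (\<Inter>\<nu>\<in>{1..}. ell (2 * \<nu>) (\<lambda>j. inverse (\<alpha> \<nu> j)))"
  proof
    assume "x \<in> (\<Inter>\<nu>\<in>{1..}. ell (2 * \<nu>) (\<lambda>j. inverse (\<alpha> \<nu> j)))"
    then have "x \<in> ell (2 * \<mu>) (\<lambda>j. inverse (\<alpha> \<mu> j))"
      by (rule INT_D) (use \<mu> in simp)
    then show False
      using not_\<mu> by contradiction
  qed
  have subset: "(\<Inter>\<nu>\<in>{1..}. ell (2 * \<nu>) (\<lambda>j. inverse (\<alpha> \<nu> j)))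
      \<subseteq> (\<Inter>\<nu>\<in>{1..\<nu>\<^sub>0}. ell (2 * \<nu>) (\<lambda>j. inverse (\<alpha> \<nu> j)))"
    by (rule INF_superset_mono) auto
  have "A \<subset> B" if "A \<subseteq> B" "x \<in> B" "x \<notin> A" for A B
    using that by blast
  from this[OF subset in_finite not_in_all] show ?thesis .
qed

end
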